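(* Let $\Omega$ be a domain in $\mathbb R^N$, $N\ge1$, and let $g:\Omega\times\mathbb R_+\to\mathbb R_+$ be continuous. Assume: (ND) for each $x\in\Omega$, $t\mapsto g(x,t)$ is $\ge0$ and nondecreasing on $[0,+\infty)$; (H) there is a real $C_1\ge1$ such that $g(x',a)\le C_1\,g(x,a)$ for all $a\ge 0$ whenever $x,x'\in\Omega$ and $|x'-x|\le\frac12\delta(x)$; (KOT) there are positive constants $C_2,c_0$ such that if $x\in\Omega$ and $a>0$ satisfy $\frac{g(x,a)}{a}>c_0\,\delta(x)^{-2}$, then $$\int_{2a}^\infty\frac{dt}{\sqrt{G(x,t)}}\le C_2\sqrt{\frac{a}{g(x,a)}},\qquad G(x,t)=\int_0^tg(x,s)\,ds.$$ Then there is a positive constant $\bar c$ such that for every nonnegative solution $u$ in $\Omega$ of $-\Delta u(x)+g(x,u(x))=0$, $$g(x,u(x))\le\bar c\,u(x)\,\delta(x)^{-2}\quad\text{for all }x\in\Omega.$$ The constant $\bar c$ may be chosen depending only on $N$, $c_0$, $C_1$ and $C_2$.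
   Context: $\delta(x)=\mathrm{dist}(x,\mathbb R^N\setminus\Omega)$ and $\mathbb R_+=[0,\infty)$. A nonnegative function $u$ in $\Omega$ is a solution if $u$ and $g(\cdot,u(\cdot))$ are in $L^1_{loc}(\Omega)$ and $\Delta u=g(\cdot,u(\cdot))$ in the sense of distributions (such $u$ is taken to be continuous). *)

theory Defs
  imports "HOL-Analysis.Analysis"
begin

text \<open>
  The value is infinity when the set is the whole space (so that its square has inverse 0);
  \<open>infdist\<close> would return 0 there.
\<close>

definition bdist :: "'a::metric_space set \<Rightarrow> 'a \<Rightarrow> ereal"
  where "bdist \<Omega> x = (INF y\<in>- \<Omega>. ereal (dist x y))"

definition partial_deriv :: "'a::euclidean_space \<Rightarrow> ('a \<Rightarrow> real) \<Rightarrow> 'a \<Rightarrow> real"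
  where "partial_deriv b f x = frechet_derivative f (at x) b"

text \<open>
  A function all of whose iterated partial derivatives are differentiable has continuous partial
  derivatives of every order.
\<close>

definition C_infinity :: "('a::euclidean_space \<Rightarrow> real) \<Rightarrow> bool"
  where "C_infinity f \<longleftrightarrow>
    (\<forall>bs. set bs \<subseteq> Basis \<longrightarrow> foldr partial_deriv bs f differentiable_on UNIV)"

definition laplacian :: "('a::euclidean_space \<Rightarrow> real) \<Rightarrow> 'a \<Rightarrow> real"
  where "laplacian f x = (\<Sum>b\<in>Basis. partial_deriv b (partial_deriv b f) x)"

definition test_functions :: "'a::euclidean_space set \<Rightarrow> ('a \<Rightarrow> real) set"
  where "test_functions \<Omega> =
    {\<phi>. C_infinity \<phi> \<and> compact (closure {x. \<phi> x \<noteq> 0}) \<and> closure {x. \<phi> x \<noteq> 0} \<subseteq> \<Omega>}"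

definition L1_loc :: "'a::euclidean_space set \<Rightarrow> ('a \<Rightarrow> real) \<Rightarrow> bool"
  where "L1_loc \<Omega> f \<longleftrightarrow> (\<forall>K. compact K \<and> K \<subseteq> \<Omega> \<longrightarrow> set_integrable lebesgue K f)"

definition distributional_laplacian ::
    "'a::euclidean_space set \<Rightarrow> ('a \<Rightarrow> real) \<Rightarrow> ('a \<Rightarrow> real) \<Rightarrow> bool"
  where "distributional_laplacian \<Omega> u f \<longleftrightarrow>
    (\<forall>\<phi>\<in>test_functions \<Omega>.
      (LINT x:\<Omega>|lebesgue. u x * laplacian \<phi> x) = (LINT x:\<Omega>|lebesgue. f x * \<phi> x))"

definition nonneg_solution ::
    "'a::euclidean_space set \<Rightarrow> ('a \<Rightarrow> real \<Rightarrow> real) \<Rightarrow> ('a \<Rightarrow> real) \<Rightarrow> bool"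
  where "nonneg_solution \<Omega> g u \<longleftrightarrow>
    (\<forall>x\<in>\<Omega>. 0 \<le> u x) \<and> continuous_on \<Omega> u \<and>
    L1_loc \<Omega> u \<and> L1_loc \<Omega> (\<lambda>x. g x (u x)) \<and>
    distributional_laplacian \<Omega> u (\<lambda>x. g x (u x))"

definition cond_ND :: "'a set \<Rightarrow> ('a \<Rightarrow> real \<Rightarrow> real) \<Rightarrow> bool"
  where "cond_ND \<Omega> g \<longleftrightarrow> (\<forall>x\<in>\<Omega>. (\<forall>t\<ge>0. 0 \<le> g x t) \<and> mono_on {0..} (g x))"

definition cond_H :: "real \<Rightarrow> 'a::metric_space set \<Rightarrow> ('a \<Rightarrow> real \<Rightarrow> real) \<Rightarrow> bool"
  where "cond_H C\<^sub>1 \<Omega> g \<longleftrightarrow>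
    (\<forall>x\<in>\<Omega>. \<forall>x'\<in>\<Omega>. ereal (dist x' x) \<le> bdist \<Omega> x / 2 \<longrightarrow> (\<forall>a\<ge>0. g x' a \<le> C\<^sub>1 * g x a))"

definition primitive :: "('a \<Rightarrow> real \<Rightarrow> real) \<Rightarrow> 'a \<Rightarrow> real \<Rightarrow> real"
  where "primitive g x t = integral {0..t} (g x)"

text \<open>
  The integral is taken in the extended nonnegative reals, so that the bound includes its
  convergence. The hypothesis on \<open>a\<close> forces \<open>g x a > 0\<close>, hence, for nondecreasing \<open>g x\<close>,
  the square root is positive on the range of integration.
\<close>

definition cond_KOT ::
    "real \<Rightarrow> real \<Rightarrow> 'a::metric_space set \<Rightarrow> ('a \<Rightarrow> real \<Rightarrow> real) \<Rightarrow> bool"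
  where "cond_KOT C\<^sub>2 c\<^sub>0 \<Omega> g \<longleftrightarrow>
    (\<forall>x\<in>\<Omega>. \<forall>a>0. ereal (g x a / a) > ereal c\<^sub>0 * inverse ((bdist \<Omega> x)\<^sup>2) \<longrightarrow>
      (\<integral>\<^sup>+t\<in>{2 * a..}. ennreal (1 / sqrt (primitive g x t)) \<partial>lborel)
        \<le> ennreal (C\<^sub>2 * sqrt (a / g x a)))"

end

theory Submission
  imports Defs
begin

text \<open>
  The idea is a discrete form of the Keller-Osserman argument. Fix \<open>x\<^sub>0\<close> and let \<open>f = g x\<^sub>0 / C\<^sub>1\<close>. On the
  ball of radius \<open>\<delta>(x\<^sub>0)/3\<close> the comparison hypothesis gives \<open>\<Delta> u \<ge> f (u)\<close>, an inequality whose right-hand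
  side no longer depends on the point. Since \<open>f\<close> is nondecreasing, \<open>\<Delta> u \<ge> f (m)\<close> wherever \<open>u > m\<close>. By a
  maximum principle (\<open>laplacian_growth\<close>), a point at which \<open>u > m\<close> therefore has within distance
  \<open>\<surd>(4 N m / f m)\<close> a point at which \<open>u > 2 m\<close>. Starting from \<open>u x\<^sub>0 > a\<close> and doubling for ever gives
  a sequence along which \<open>u\<close> is unbounded, and the length of the path through it is at most
  \<open>\<Sum>k. \<surd>(4 N 2\<^sup>k a / f (2\<^sup>k a))\<close>. By monotonicity this sum is bounded by a multiple of the
  Keller-Osserman integral plus \<open>\<surd>(a / f a)\<close> (\<open>keller_osserman_dyadic\<close>). If \<open>g x\<^sub>0 a / a\<close> exceeds
  \<open>c\<^sub>0 \<delta>(x\<^sub>0)\<^sup>-\<^sup>2\<close>, the integral condition makes it at most a constant \<open>A\<close> times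
  \<open>\<surd>(a / g x\<^sub>0 a)\<close>. If \<open>g x\<^sub>0 a / a\<close> exceeded also \<open>9 A\<^sup>2 \<delta>(x\<^sub>0)\<^sup>-\<^sup>2\<close>, the path would stay in a compact
  part of that ball, where the continuous function \<open>u\<close> is bounded. So \<open>u x\<^sub>0 \<le> a\<close> for every such \<open>a\<close>
  (\<open>keller_osserman_bound\<close>), and this contradicts a violation of the claim at a positive value
  \<open>u x\<^sub>0\<close> by taking \<open>a\<close> slightly below it.

  If \<open>u x\<^sub>0 = 0\<close>, the claim says that \<open>g x\<^sub>0 0 = 0\<close>. This follows from monotonicity and the integral condition:
  otherwise \<open>a / g x\<^sub>0 a\<close> would tend to 0 with \<open>a\<close>, while the integral from \<open>2 a\<close> is bounded below.

  The maximum principle for distributional Laplacians is obtained by mollifying \<open>u\<close> with a smooth bump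
  and comparing second differences of the mollification at a maximum point with the integral of \<open>u\<close>
  against the Laplacian of the bump, which is itself a test function.
\<close>

section \<open>A smooth bump function\<close>

text \<open>
  The powers of \<open>1/t\<close> make the family stable under differentiation: the derivative of each member
  is a linear combination of two members with larger exponents.
\<close>

definition flat_exp :: "nat \<Rightarrow> real \<Rightarrow> real"
  where "flat_exp k t = (if 0 < t then exp (- inverse t) * inverse t ^ k else 0)"

lemma flat_exp_tendsto_0: "(flat_exp k \<longlongrightarrow> 0) (at_right 0)"
proof -
  have "((\<lambda>t::real. inverse t ^ k / exp (inverse t)) \<longlongrightarrow> 0) (at_right 0)"
    using filterlim_compose[OF tendsto_power_div_exp_0 filterlim_inverse_at_top_right] .
  then show ?thesis
    by (rule Lim_transform_eventually)
      (auto simp: flat_exp_def eventually_at_filter exp_minus divide_inverse mult.commute)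
qed

text \<open>
  At \<open>t = 0\<close> the difference quotient is \<open>flat_exp (k + 1)\<close> from the right and 0 from the left.
\<close>

lemma flat_exp_deriv:
  "(flat_exp k has_real_derivative flat_exp (k + 2) t - real k * flat_exp (k + 1) t) (at t)"
proof -
  consider "t < 0" | "t = 0" | "t > 0" by linarith
  then show ?thesis
  proof cases
    case 1
    have "(flat_exp k has_real_derivative 0) (at t)"
      by (rule has_field_derivative_transform_within_open[of "\<lambda>_. 0" _ _ "{..<0}"])
        (use 1 in \<open>auto simp: flat_exp_def\<close>)
    with 1 show ?thesis by (simp add: flat_exp_def)
  next
    case 2
    have "((\<lambda>h. flat_exp k h / h) \<longlongrightarrow> 0) (at_right 0)"
      by (rule Lim_transform_eventually[OF flat_exp_tendsto_0[of "k + 1"]])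
        (auto simp: flat_exp_def eventually_at_filter divide_inverse)
    moreover have "((\<lambda>h. flat_exp k h / h) \<longlongrightarrow> 0) (at_left 0)"
      by (rule Lim_transform_eventually[OF tendsto_const])
        (auto simp: flat_exp_def eventually_at_filter)
    ultimately have "((\<lambda>h. flat_exp k h / h) \<longlongrightarrow> 0) (at 0)"
      by (simp add: filterlim_split_at)
    then show ?thesis using 2 by (simp add: has_field_derivative_iff flat_exp_def)
  next
    case 3
    have "((\<lambda>t. exp (- inverse t) * inverse t ^ k) has_real_derivative
        exp (- inverse t) * (inverse t * inverse t) * inverse t ^ k
          + real k * (- (inverse t * inverse t)) * inverse t ^ (k - 1) * exp (- inverse t)) (at t)"
      using 3 by (auto intro!: derivative_eq_intros simp: power2_eq_square)
    also have "exp (- inverse t) * (inverse t * inverse t) * inverse t ^ k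
          + real k * (- (inverse t * inverse t)) * inverse t ^ (k - 1) * exp (- inverse t)
        = exp (- inverse t) * inverse t ^ (k + 2)
          - real k * (exp (- inverse t) * inverse t ^ (k + 1))"
      by (cases k) (simp_all add: algebra_simps)
    finally have *: "((\<lambda>t. exp (- inverse t) * inverse t ^ k) has_real_derivative
        exp (- inverse t) * inverse t ^ (k + 2)
          - real k * (exp (- inverse t) * inverse t ^ (k + 1))) (at t)" .
    from * have "(flat_exp k has_real_derivative exp (- inverse t) * inverse t ^ (k + 2)
          - real k * (exp (- inverse t) * inverse t ^ (k + 1))) (at t)"
      by (rule has_field_derivative_transform_within_open[of _ _ _ "{0<..}"])
        (use 3 in \<open>auto simp: flat_exp_def\<close>)
    with 3 show ?thesis by (simp add: flat_exp_def)
  qed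
qed

definition bump :: "real \<Rightarrow> 'a::euclidean_space \<Rightarrow> real"
  where "bump r x = flat_exp 0 (r\<^sup>2 - x \<bullet> x)"

text \<open>
  All iterated partial derivatives of a translated bump lie in one algebra of differentiable
  functions. Closure of this algebra under partial derivatives gives smoothness without any formula
  for the higher derivatives.
\<close>

inductive_set bump_algebra :: "real \<Rightarrow> 'a::euclidean_space \<Rightarrow> ('a \<Rightarrow> real) set"
  for r :: real and z :: 'a where
  const: "(\<lambda>x. c) \<in> bump_algebra r z"
| coord: "(\<lambda>x. x \<bullet> b) \<in> bump_algebra r z"
| gen: "(\<lambda>x. flat_exp k (r\<^sup>2 - (x - z) \<bullet> (x - z))) \<in> bump_algebra r z"
| add: "f \<in> bump_algebra r z \<Longrightarrow> h \<in> bump_algebra r z \<Longrightarrow> (\<lambda>x. f x + h x) \<in> bump_algebra r z"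
| mult: "f \<in> bump_algebra r z \<Longrightarrow> h \<in> bump_algebra r z \<Longrightarrow> (\<lambda>x. f x * h x) \<in> bump_algebra r z"

lemma bump_algebra_derivative:
  assumes "f \<in> bump_algebra r z"
  shows "\<exists>f'. (\<forall>x. (f has_derivative f' x) (at x)) \<and> (\<forall>b. (\<lambda>x. f' x b) \<in> bump_algebra r z)"
  using assms
proof induction
  case (const c)
  show ?case by (rule exI[of _ "\<lambda>x h. 0"]) (auto intro: bump_algebra.const)
next
  case (coord b)
  show ?case
    by (rule exI[of _ "\<lambda>x h. h \<bullet> b"])
      (auto intro!: bump_algebra.const derivative_eq_intros)
next
  case (gen k)
  let ?q = "\<lambda>x. r\<^sup>2 - (x - z) \<bullet> (x - z)"
  let ?d = "\<lambda>x. flat_exp (k + 2) (?q x) - real k * flat_exp (k + 1) (?q x)"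
  let ?f' = "\<lambda>x h. ?d x * (- 2 * ((x - z) \<bullet> h))"
  have "((\<lambda>x. flat_exp k (?q x)) has_derivative ?f' x) (at x)" for x
  proof -
    have "(?q has_derivative (\<lambda>h. - 2 * ((x - z) \<bullet> h))) (at x)"
      by (auto intro!: derivative_eq_intros simp: inner_commute)
    from has_derivative_compose[OF this
        flat_exp_deriv[of k "?q x", unfolded has_field_derivative_def]]
    show ?thesis by simp
  qed
  moreover have "(\<lambda>x. ?f' x b) \<in> bump_algebra r z" for b
  proof -
    have "(\<lambda>x. (flat_exp (k + 2) (?q x) + (- real k) * flat_exp (k + 1) (?q x)) *
        ((- 2) * (x \<bullet> b + - (z \<bullet> b)))) \<in> bump_algebra r z"
      by (intro bump_algebra.intros)
    then show ?thesis by (simp add: inner_diff_left)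
  qed
  ultimately show ?case by (intro exI[of _ ?f'] conjI allI)
next
  case (add f h)
  then obtain f' h' where "\<And>x. (f has_derivative f' x) (at x)" "\<And>b. (\<lambda>x. f' x b) \<in> bump_algebra r z"
     "\<And>x. (h has_derivative h' x) (at x)" "\<And>b. (\<lambda>x. h' x b) \<in> bump_algebra r z" by blast
  then show ?case
    by (intro exI[of _ "\<lambda>x b. f' x b + h' x b"] conjI allI has_derivative_add bump_algebra.add)
next
  case (mult f h)
  then obtain f' h' where "\<And>x. (f has_derivative f' x) (at x)" "\<And>b. (\<lambda>x. f' x b) \<in> bump_algebra r z"
     "\<And>x. (h has_derivative h' x) (at x)" "\<And>b. (\<lambda>x. h' x b) \<in> bump_algebra r z" by blast
  with mult.hyps show ?case
    by (intro exI[of _ "\<lambda>x b. f x * h' x b + f' x b * h x"] conjI allI has_derivative_mult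
        bump_algebra.add bump_algebra.mult)
qed

lemma C_infinity_bump: "C_infinity (\<lambda>x. bump r (x - z))"
proof -
  have "foldr partial_deriv bs (\<lambda>x. bump r (x - z)) \<in> bump_algebra r z" for bs
  proof (induction bs)
    case Nil
    show ?case using bump_algebra.gen[of 0 r z] by (simp add: bump_def)
  next
    case (Cons b bs)
    let ?f = "foldr partial_deriv bs (\<lambda>x. bump r (x - z))"
    obtain f' where f': "\<And>x. (?f has_derivative f' x) (at x)"
       "(\<lambda>x. f' x b) \<in> bump_algebra r z" using bump_algebra_derivative[OF Cons.IH] by blast
    have "partial_deriv b ?f = (\<lambda>x. f' x b)"
      by (simp add: partial_deriv_def fun_eq_iff frechet_derivative_at[OF f'(1), symmetric])
    with f'(2) show ?case by simp
  qed
  then have "foldr partial_deriv bs (\<lambda>x. bump r (x - z)) differentiable (at x)" for bs x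
    using bump_algebra_derivative unfolding differentiable_def by blast
  then show ?thesis
    by (simp add: C_infinity_def differentiable_at_imp_differentiable_on)
qed

lemma bump_nonneg: "0 \<le> bump r x"
  by (simp add: bump_def flat_exp_def)

lemma bump_le_1: "bump r x \<le> 1"
  by (simp add: bump_def flat_exp_def)

lemma bump_pos_iff:
  assumes "0 < r"
  shows "0 < bump r x \<longleftrightarrow> norm x < r"
proof -
  have "0 < bump r x \<longleftrightarrow> (norm x)\<^sup>2 < r\<^sup>2"
    by (simp add: bump_def flat_exp_def dot_square_norm)
  also have "\<dots> \<longleftrightarrow> norm x < r"
    using assms by (meson less_imp_le norm_ge_zero power2_less_imp_less power_strict_mono zero_less_numeral)
  finally show ?thesis .
qed

lemma bump_eq_0:
  assumes "0 < r" "r \<le> norm x"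
  shows "bump r x = 0"
  using bump_pos_iff[OF assms(1), of x] bump_nonneg[of r x] assms(2) by linarith

lemma continuous_bump: "continuous_on S (bump r)"
proof -
  have "continuous_on UNIV (flat_exp 0)"
    by (rule DERIV_continuous_on, rule has_field_derivative_at_within, rule flat_exp_deriv)
  then show ?thesis
    unfolding bump_def by (rule continuous_on_compose2) (auto intro!: continuous_intros)
qed

lemma test_function_bump:
  assumes "0 < r" "cball z r \<subseteq> \<Omega>"
  shows "(\<lambda>x. bump r (x - z)) \<in> test_functions \<Omega>"
proof -
  have "{x. bump r (x - z) \<noteq> 0} \<subseteq> cball z r"
    using bump_eq_0[OF assms(1)] by (force simp: dist_norm norm_minus_commute)
  then have *: "closure {x. bump r (x - z) \<noteq> 0} \<subseteq> cball z r"
    by (simp add: closure_minimal)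
  then have "compact (closure {x. bump r (x - z) \<noteq> 0})"
    by (meson bounded_cball bounded_subset closed_closure compact_eq_bounded_closed)
  with * assms C_infinity_bump show ?thesis by (auto simp: test_functions_def)
qed

section \<open>Second differences under the integral\<close>

lemma partial_deriv_line:
  assumes "\<phi> differentiable (at (x + t *\<^sub>R e))"
  shows "((\<lambda>t. \<phi> (x + t *\<^sub>R e)) has_real_derivative partial_deriv e \<phi> (x + t *\<^sub>R e)) (at t)"
proof -
  have "((\<lambda>t. x + t *\<^sub>R e) has_derivative (\<lambda>h. h *\<^sub>R e)) (at t)"
    by (auto intro!: derivative_eq_intros)
  from has_derivative_compose[OF this assms[unfolded frechet_derivative_works]]
  show ?thesis
    by (simp add: has_field_derivative_def partial_deriv_def linear_cmul
        linear_frechet_derivative[OF assms] mult.commute[of _ "frechet_derivative _ _ _"])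
qed

lemma C_infinity_D:
  assumes "C_infinity \<phi>" "e \<in> Basis"
  shows "\<phi> differentiable (at x)" "partial_deriv e \<phi> differentiable (at x)"
    "partial_deriv e (partial_deriv e \<phi>) differentiable (at x)"
proof -
  have *: "foldr partial_deriv bs \<phi> differentiable (at x)" if "set bs \<subseteq> Basis" for bs
    using assms(1) that by (simp add: C_infinity_def differentiable_on_def)
  show "\<phi> differentiable (at x)" using *[of "[]"] by simp
  show "partial_deriv e \<phi> differentiable (at x)" using *[of "[e]"] assms(2) by simp
  show "partial_deriv e (partial_deriv e \<phi>) differentiable (at x)"
    using *[of "[e, e]"] assms(2) by simp
qed

text \<open>
  Maclaurin's theorem of order 2 is applied to the even function
  \<open>t \<mapsto> \<phi> (x + t e) + \<phi> (x - t e)\<close>, whose first derivative at 0 vanishes.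
\<close>

lemma second_difference_mean_value:
  assumes "C_infinity \<phi>" "e \<in> Basis" "0 < t"
  obtains \<xi> where "0 < \<xi>" "\<xi> < t"
    "(\<phi> (x + t *\<^sub>R e) + \<phi> (x - t *\<^sub>R e) - 2 * \<phi> x) / t\<^sup>2
      = (partial_deriv e (partial_deriv e \<phi>) (x + \<xi> *\<^sub>R e)
          + partial_deriv e (partial_deriv e \<phi>) (x - \<xi> *\<^sub>R e)) / 2"
proof -
  note d = C_infinity_D[OF assms(1,2)]
  let ?a = "partial_deriv e \<phi>" and ?b = "partial_deriv e (partial_deriv e \<phi>)"
  define diff where "diff m t = (if m = 0 then \<phi> (x + t *\<^sub>R e) + \<phi> (x + (- t) *\<^sub>R e)
    else if m = 1 then ?a (x + t *\<^sub>R e) - ?a (x + (- t) *\<^sub>R e)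
    else ?b (x + t *\<^sub>R e) + ?b (x + (- t) *\<^sub>R e))" for m :: nat and t :: real
  have minus: "((\<lambda>t. f (x + (- t) *\<^sub>R e)) has_real_derivative - partial_deriv e f (x + (- t) *\<^sub>R e)) (at t)"
    if "\<And>x. f differentiable (at x)" for f :: "'a \<Rightarrow> real" and t
  proof -
    have "((\<lambda>t. f (x + t *\<^sub>R e)) has_real_derivative partial_deriv e f (x + (- t) *\<^sub>R e)) (at (- t))"
      by (rule partial_deriv_line[OF that])
    from DERIV_chain2[OF this DERIV_minus[OF DERIV_ident]] show ?thesis by simp
  qed
  have "\<forall>m t'. m < 2 \<and> 0 \<le> t' \<and> t' \<le> t \<longrightarrow> DERIV (diff m) t' :> diff (Suc m) t'"
  proof (intro allI impI)
    fix m :: nat and t' :: real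
    assume "m < 2 \<and> 0 \<le> t' \<and> t' \<le> t"
    then consider "m = 0" | "m = 1" by linarith
    then show "DERIV (diff m) t' :> diff (Suc m) t'"
    proof cases
      case 1
      have "((\<lambda>t. \<phi> (x + t *\<^sub>R e) + \<phi> (x + (- t) *\<^sub>R e)) has_real_derivative
          ?a (x + t' *\<^sub>R e) + - ?a (x + (- t') *\<^sub>R e)) (at t')"
        by (intro DERIV_add partial_deriv_line minus d)
      with 1 show ?thesis by (simp add: diff_def[abs_def])
    next
      case 2
      have "((\<lambda>t. ?a (x + t *\<^sub>R e) - ?a (x + (- t) *\<^sub>R e)) has_real_derivative
          ?b (x + t' *\<^sub>R e) - - ?b (x + (- t') *\<^sub>R e)) (at t')"
        by (intro DERIV_diff partial_deriv_line minus d)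
      with 2 show ?thesis by (simp add: diff_def[abs_def])
    qed
  qed
  from Maclaurin[OF assms(3) _ refl this]
  obtain \<xi> where \<xi>: "0 < \<xi>" "\<xi> < t"
    and "diff 0 t = (\<Sum>m<2. diff m 0 / fact m * t ^ m) + diff 2 \<xi> / fact 2 * t\<^sup>2" by auto
  then have "(\<phi> (x + t *\<^sub>R e) + \<phi> (x - t *\<^sub>R e) - 2 * \<phi> x) =
      (?b (x + \<xi> *\<^sub>R e) + ?b (x - \<xi> *\<^sub>R e)) / 2 * t\<^sup>2"
    by (simp add: diff_def numeral_2_eq_2)
  with that[OF \<xi>] assms(3) show ?thesis by simp
qed

lemma partial_deriv_eq_0_outside:
  assumes "\<And>x. x \<notin> S \<Longrightarrow> f x = 0" "closed S" "x \<notin> S"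
  shows "partial_deriv e f x = 0"
proof -
  have "(f has_derivative (\<lambda>_. 0)) (at x)"
    by (rule has_derivative_transform_within_open[of "\<lambda>_. 0" _ _ UNIV "- S"])
      (use assms in auto)
  then show ?thesis
    by (simp add: partial_deriv_def frechet_derivative_at[symmetric])
qed

lemma continuous_vanishing_bounded:
  fixes f :: "'a::euclidean_space \<Rightarrow> real"
  assumes "continuous_on UNIV f" "\<And>x. x \<notin> cball z r \<Longrightarrow> f x = 0"
  obtains B where "0 \<le> B" "\<And>x. \<bar>f x\<bar> \<le> B"
proof -
  have "compact (f ` cball z r)"
    by (intro compact_continuous_image continuous_on_subset[OF assms(1)]) auto
  then obtain B where B: "\<And>x. x \<in> cball z r \<Longrightarrow> \<bar>f x\<bar> \<le> B"
    using compact_imp_bounded[THEN bounded_iff[THEN iffD1]] by (metis image_eqI real_norm_def)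
  have "\<bar>f x\<bar> \<le> max 0 B" for x
    using B[of x] assms(2)[of x] by (cases "x \<in> cball z r") auto
  with that[of "max 0 B"] show ?thesis by simp
qed

lemma integrable_bounded_cball:
  fixes f :: "'a::euclidean_space \<Rightarrow> real"
  assumes "f \<in> borel_measurable lborel" "\<And>x. \<bar>f x\<bar> \<le> B * indicator (cball z r) x"
  shows "integrable lborel f"
proof (rule Bochner_Integration.integrable_bound)
  show "integrable lborel (\<lambda>x. B * indicator (cball z r) x :: real)"
    using emeasure_lborel_cball_finite[of z r] by simp
  show "AE x in lborel. norm (f x) \<le> norm (B * indicator (cball z r) x :: real)"
    using assms(2) by (intro AE_I2) (metis abs_ge_self order_trans real_norm_def)
qed fact

text \<open>
  The tool that links maxima of a mollification with the distributional Laplacian: second differences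
  of the convolution converge to the integral against the second derivative of the kernel, so that no
  differentiation of the convolution itself is needed. By the mean value form the quotients are
  bounded by the supremum of the second derivative, and they vanish outside a fixed ball, which gives
  the domination.
\<close>

lemma second_difference_integral_tendsto:
  fixes \<phi> :: "'a::euclidean_space \<Rightarrow> real"
  assumes \<phi>: "C_infinity \<phi>" and e: "e \<in> Basis"
    and supp: "\<And>x. x \<notin> cball z r \<Longrightarrow> \<phi> x = 0"
    and v [measurable]: "v \<in> borel_measurable lborel" and vB: "\<And>x. \<bar>v x\<bar> \<le> V"
  defines "D \<equiv> \<lambda>t x. (\<phi> (x + t *\<^sub>R e) + \<phi> (x - t *\<^sub>R e) - 2 * \<phi> x) / t\<^sup>2"
  shows "integrable lborel (\<lambda>x. v x * partial_deriv e (partial_deriv e \<phi>) x)" (is ?int)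
    and "(\<lambda>n. LINT x|lborel. v x * D (inverse (real (Suc n))) x)
      \<longlonglongrightarrow> (LINT x|lborel. v x * partial_deriv e (partial_deriv e \<phi>) x)" (is ?lim)
proof -
  let ?b = "partial_deriv e (partial_deriv e \<phi>)"
  let ?t = "\<lambda>n. inverse (real (Suc n))"
  note d = C_infinity_D[OF \<phi> e]
  have cont: "continuous_on UNIV \<phi>" "continuous_on UNIV ?b"
    using d by (auto intro!: differentiable_imp_continuous_on differentiable_at_imp_differentiable_on)
  then have [measurable]: "\<phi> \<in> borel_measurable lborel" "?b \<in> borel_measurable lborel"
    by (auto intro: borel_measurable_continuous_onI)
  have b0: "?b x = 0" if "x \<notin> cball z r" for x
    by (rule partial_deriv_eq_0_outside[OF partial_deriv_eq_0_outside[OF supp closed_cball]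
          closed_cball that])
  obtain B where B: "0 \<le> B" "\<And>x. \<bar>?b x\<bar> \<le> B"
    using continuous_vanishing_bounded[OF cont(2) b0] by blast
  have D_lim: "(\<lambda>n. D (?t n) x) \<longlonglongrightarrow> ?b x" for x
  proof -
    have "\<exists>\<xi>. 0 < \<xi> \<and> \<xi> < ?t n \<and> D (?t n) x = (?b (x + \<xi> *\<^sub>R e) + ?b (x - \<xi> *\<^sub>R e)) / 2" for n
      using second_difference_mean_value[OF \<phi> e, of "?t n" x] unfolding D_def
      by (metis inverse_positive_iff_positive of_nat_0_less_iff zero_less_Suc)
    then obtain \<xi> where \<xi>: "\<And>n. 0 < \<xi> n" "\<And>n. \<xi> n < ?t n"
      and D: "\<And>n. D (?t n) x = (?b (x + \<xi> n *\<^sub>R e) + ?b (x - \<xi> n *\<^sub>R e)) / 2" by metis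
    have \<xi>0: "\<xi> \<longlonglongrightarrow> 0"
      by (rule tendsto_sandwich[OF _ _ tendsto_const LIMSEQ_inverse_real_of_nat])
        (use \<xi> in \<open>auto intro!: always_eventually less_imp_le\<close>)
    have c: "isCont ?b y" for y
      using cont(2) by (simp add: continuous_on_eq_continuous_at)
    have "(\<lambda>n. ?b (x + \<xi> n *\<^sub>R e)) \<longlonglongrightarrow> ?b (x + 0 *\<^sub>R e)"
      "(\<lambda>n. ?b (x - \<xi> n *\<^sub>R e)) \<longlonglongrightarrow> ?b (x - 0 *\<^sub>R e)"
      by (rule isCont_tendsto_compose[OF c]; intro tendsto_intros \<xi>0)+
    from tendsto_divide[OF tendsto_add[OF this] tendsto_const[of 2]]
    show ?thesis unfolding D by simp
  qed
  have D_bound: "\<bar>D (?t n) x\<bar> \<le> B" for n x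
  proof -
    obtain \<xi> where D: "D (?t n) x = (?b (x + \<xi> *\<^sub>R e) + ?b (x - \<xi> *\<^sub>R e)) / 2"
      using second_difference_mean_value[OF \<phi> e, of "?t n" x] unfolding D_def
      by (metis inverse_positive_iff_positive of_nat_0_less_iff zero_less_Suc)
    have "\<bar>(p + q) / 2\<bar> \<le> B" if "\<bar>p\<bar> \<le> B" "\<bar>q\<bar> \<le> B" for p q :: real
      using that by (simp add: abs_le_iff)
    from this[OF B(2) B(2)] show ?thesis unfolding D .
  qed
  have D_supp: "D (?t n) x = 0" if "x \<notin> cball z (r + 1)" for n x
  proof -
    have t: "norm (?t n *\<^sub>R e) \<le> 1" using e by (simp add: inverse_le_1_iff)
    have "x \<notin> cball z r" using that by auto
    moreover have "x + ?t n *\<^sub>R e \<notin> cball z r" "x - ?t n *\<^sub>R e \<notin> cball z r"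
      using that t norm_triangle_ineq2[of "z - x" "?t n *\<^sub>R e"]
        norm_triangle_ineq2[of "z - x" "- (?t n *\<^sub>R e)"]
      by (auto simp: dist_norm algebra_simps)
    ultimately show ?thesis using supp by (simp add: D_def)
  qed
  have prod: "\<bar>v x * w\<bar> \<le> V * B" if "\<bar>w\<bar> \<le> B" for w x
    using mult_mono[OF vB[of x] that] vB[of x] by (simp add: abs_mult)
  show ?int
    by (rule integrable_bounded_cball[of _ "V * B" z r], measurable)
      (use prod[OF B(2)] b0 in \<open>auto simp: indicator_def\<close>)
  have "integrable lborel (\<lambda>x. V * B * indicator (cball z (r + 1)) x)"
    using emeasure_lborel_cball_finite[of z "r + 1"] by simp
  then show ?lim
  proof (rule integral_dominated_convergence[rotated 2])
    show "AE x in lborel. (\<lambda>n. v x * D (?t n) x) \<longlonglongrightarrow> v x * ?b x"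
      by (intro AE_I2 tendsto_mult tendsto_const D_lim)
    show "AE x in lborel. norm (v x * D (?t n) x) \<le> V * B * indicator (cball z (r + 1)) x" for n
      by (intro AE_I2) (use prod[OF D_bound] D_supp in \<open>auto simp: indicator_def\<close>)
  qed (simp_all add: D_def)
qed

section \<open>Mollification\<close>

lemma lborel_integral_shift:
  fixes f :: "'a::euclidean_space \<Rightarrow> real"
  assumes [measurable]: "f \<in> borel_measurable borel"
  shows "(LINT x|lborel. f (x - z)) = (LINT x|lborel. f x)"
proof -
  have "(LINT x|lborel. f x) = (LINT x|distr lborel borel ((+) (- z)). f x)"
    by (simp only: lborel_distr_plus)
  also have "\<dots> = (LINT x|lborel. f (x - z))"
    by (subst integral_distr) auto
  finally show ?thesis by simp
qed

lemma measurable_bump [measurable]: "(\<lambda>x. bump r (x - z)) \<in> borel_measurable borel"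
  by (intro borel_measurable_continuous_onI continuous_on_compose2[OF continuous_bump[of UNIV]]
      continuous_intros) auto

lemma bump_indicator:
  assumes "0 < r"
  shows "bump r (x - z) \<le> indicator (cball z r) x"
proof (cases "x \<in> cball z r")
  case True then show ?thesis using bump_le_1 by simp
next
  case False
  then have "r \<le> norm (x - z)" by (simp add: dist_norm norm_minus_commute)
  from bump_eq_0[OF assms this] show ?thesis by simp
qed

lemma integrable_mult_bump:
  fixes v :: "'a::euclidean_space \<Rightarrow> real"
  assumes "0 < r" and [measurable]: "v \<in> borel_measurable borel" and vB: "\<And>x. \<bar>v x\<bar> \<le> V"
  shows "integrable lborel (\<lambda>x. v x * bump r (x - z))"
proof (rule integrable_bounded_cball)
  show "\<bar>v x * bump r (x - z)\<bar> \<le> V * indicator (cball z r) x" for x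
    using mult_mono[OF vB[of x] bump_indicator[OF assms(1), of x z]] vB[of x] bump_nonneg[of r "x - z"]
    by (simp add: abs_mult)
qed measurable

lemma integrable_bump:
  assumes "0 < r"
  shows "integrable lborel (\<lambda>x :: 'a::euclidean_space. bump r (x - z))"
  using integrable_mult_bump[OF assms, of "\<lambda>_. 1" 1 z] by simp

lemma bump_mass_pos:
  assumes "0 < r"
  shows "0 < (LINT x|lborel. bump r (x :: 'a::euclidean_space))"
proof -
  have int: "integrable lborel (bump r :: 'a \<Rightarrow> real)"
    using integrable_bump[OF assms, of 0] by simp
  have "\<not> (AE x :: 'a in lborel. bump r x = 0)"
  proof
    assume "AE x :: 'a in lborel. bump r x = 0"
    then have "AE x :: 'a in lborel. x \<notin> ball 0 r"
      by eventually_elim (use bump_pos_iff[OF assms] in \<open>force simp: dist_norm\<close>)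
    then have "emeasure lborel (ball 0 r :: 'a set) = 0"
      by (subst (asm) AE_iff_measurable[of "ball 0 r"]) auto
    moreover have "emeasure lborel (ball 0 r :: 'a set) \<noteq> 0"
      using assms open_not_negligible[of "ball 0 r :: 'a set"]
      by (simp add: negligible_iff_emeasure0 )
    ultimately show False by simp
  qed
  then have "(LINT x|lborel. bump r (x :: 'a)) \<noteq> 0"
    using integral_nonneg_eq_0_iff_AE[OF int] by (simp add: bump_nonneg)
  moreover have "0 \<le> (LINT x|lborel. bump r (x :: 'a))"
    by (intro Bochner_Integration.integral_nonneg) (simp add: bump_nonneg)
  ultimately show ?thesis by simp
qed

text \<open>
  The mass of the bump is not normalized; it appears as a factor here and later.
\<close>

lemma mollified_close:
  fixes v :: "'a::euclidean_space \<Rightarrow> real"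
  assumes r: "0 < r" and [measurable]: "v \<in> borel_measurable borel" and vB: "\<And>x. \<bar>v x\<bar> \<le> V"
    and close: "\<And>x. x \<in> cball z r \<Longrightarrow> \<bar>v x - c\<bar> \<le> \<eta>"
  shows "\<bar>(LINT x|lborel. v x * bump r (x - z)) - c * (LINT x|lborel. bump r (x :: 'a))\<bar>
    \<le> \<eta> * (LINT x|lborel. bump r (x :: 'a))"
proof -
  note int = integrable_mult_bump[OF r assms(2) vB, of z] integrable_bump[OF r, of z]
  have shift: "(LINT x|lborel. bump r (x - z)) = (LINT x|lborel. bump r (x :: 'a))"
    using measurable_bump[of r 0] by (intro lborel_integral_shift) simp
  have "(LINT x|lborel. v x * bump r (x - z)) - c * (LINT x|lborel. bump r (x :: 'a))
      = (LINT x|lborel. v x * bump r (x - z) - c * bump r (x - z))"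
    using int by (simp add: shift)
  also have "\<bar>\<dots>\<bar> \<le> (LINT x|lborel. \<eta> * bump r (x - z))"
  proof (rule integral_abs_bound[THEN order_trans], rule integral_mono)
    show "\<bar>v x * bump r (x - z) - c * bump r (x - z)\<bar> \<le> \<eta> * bump r (x - z)" for x
    proof (cases "x \<in> cball z r")
      case True
      then show ?thesis
        using mult_right_mono[OF close[OF True] bump_nonneg[of r "x - z"]] bump_nonneg[of r "x - z"]
        by (simp add: abs_mult flip: left_diff_distrib)
    next
      case False
      then have "bump r (x - z) = 0"
        using bump_eq_0[OF r, of "x - z"] by (simp add: dist_norm norm_minus_commute)
      then show ?thesis by simp
    qed
  qed (use int in auto)
  also have "\<dots> = \<eta> * (LINT x|lborel. bump r (x :: 'a))"
    by (simp add: shift)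
  finally show ?thesis .
qed

lemma mollified_continuous:
  fixes v :: "'a::euclidean_space \<Rightarrow> real"
  assumes r: "0 < r" and [measurable]: "v \<in> borel_measurable borel" and vB: "\<And>x. \<bar>v x\<bar> \<le> V"
  shows "continuous_on S (\<lambda>z. LINT x|lborel. v x * bump r (x - z))"
proof (rule continuous_on_sequentiallyI)
  fix Z z assume "Z \<longlonglongrightarrow> (z :: 'a)"
  then obtain M where M: "\<And>n. norm (Z n) \<le> M"
    using Bseq_def convergentI convergent_imp_Bseq by metis
  have "integrable lborel (\<lambda>x. V * indicator (cball (0 :: 'a) (r + M)) x :: real)"
    using emeasure_lborel_cball_finite[of "0 :: 'a" "r + M"] by simp
  then show "(\<lambda>n. LINT x|lborel. v x * bump r (x - Z n)) \<longlonglongrightarrow> (LINT x|lborel. v x * bump r (x - z))"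
  proof (rule integral_dominated_convergence[rotated 2])
    have "isCont (bump r) y" for y :: 'a
      using continuous_bump[of "UNIV :: 'a set" r] by (simp add: continuous_on_eq_continuous_at)
    then have "(\<lambda>n. bump r (x - Z n)) \<longlonglongrightarrow> bump r (x - z)" for x
      by (rule isCont_tendsto_compose) (intro tendsto_intros \<open>Z \<longlonglongrightarrow> z\<close>)
    then show "AE x in lborel. (\<lambda>n. v x * bump r (x - Z n)) \<longlonglongrightarrow> v x * bump r (x - z)"
      by (intro AE_I2 tendsto_mult tendsto_const)
    have ind: "indicator (cball (Z n) r) x \<le> (indicator (cball 0 (r + M)) x :: real)" for n x
      using M[of n] norm_triangle_ineq[of "x - Z n" "Z n"]
      by (auto simp: indicator_def dist_norm norm_minus_commute)
    have "\<bar>v x * bump r (x - Z n)\<bar> \<le> V * indicator (cball 0 (r + M)) x" for n x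
      using mult_mono[OF vB[of x] order_trans[OF bump_indicator[OF r] ind[of n x]]]
        vB[of x] bump_nonneg[of r "x - Z n"] by (simp add: abs_mult)
    then show "AE x in lborel. norm (v x * bump r (x - Z n)) \<le> V * indicator (cball 0 (r + M)) x" for n
      by simp
  qed simp_all
qed

section \<open>Growth of subsolutions\<close>

text \<open>
  A function with Laplacian at least \<open>\<kappa>\<close> wherever it exceeds \<open>m\<close> grows quadratically from any point
  at which it exceeds \<open>m\<close>, however slightly. Classically, with \<open>N\<close> the dimension and \<open>c = \<kappa> / (4 N)\<close>,
  the function \<open>u - c |x - x\<^sub>1|\<^sup>2\<close> is strictly subharmonic on \<open>{u > m}\<close>, exceeds \<open>m\<close> at \<open>x\<^sub>1\<close> and is at most
  \<open>m\<close> on the part of the boundary of \<open>{u > m}\<close> inside the ball; its maximum must then be on the sphere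
  of radius \<open>s\<close>. As \<open>u\<close> is only continuous and the equation only distributional, this is carried out
  for a mollification \<open>U\<close>: if the conclusion failed, \<open>U\<close> minus the quadratic would have an interior
  maximum \<open>z\<close>, where the second differences of \<open>U\<close> in the coordinate directions are at most those of
  the quadratic. In the limit, testing the equation with the bump centred at \<open>z\<close> gives
  \<open>\<kappa> \<le> 2 N c = \<kappa> / 2\<close>. The factor 4 in place of the sharp 2 provides this gap.
\<close>

lemma laplacian_growth:
  fixes u h :: "'a::euclidean_space \<Rightarrow> real"
  assumes sol: "distributional_laplacian \<Omega> u h"
    and cont: "continuous_on (cball x\<^sub>1 s') u" and h_int: "set_integrable lebesgue (cball x\<^sub>1 s') h"
    and sub: "cball x\<^sub>1 s' \<subseteq> \<Omega>" and s: "0 \<le> s" "s < s'"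
    and m: "m < u x\<^sub>1" and \<kappa>: "0 < \<kappa>"
    and h_ge: "\<And>x. x \<in> cball x\<^sub>1 s' \<Longrightarrow> m < u x \<Longrightarrow> \<kappa> \<le> h x"
  shows "\<exists>y\<in>cball x\<^sub>1 s. m + \<kappa> / (4 * real DIM('a)) * s\<^sup>2 < u y"
proof (rule ccontr)
  define c where "c = \<kappa> / (4 * real DIM('a))"
  assume "\<not> ?thesis"
  then have u_le: "u y \<le> m + c * s\<^sup>2" if "y \<in> cball x\<^sub>1 s" for y
    using that by (force simp: c_def)
  have c: "0 < c" using \<kappa> by (simp add: c_def)
  define C where "C = cball x\<^sub>1 s'"
  define v where "v x = indicator C x * u x" for x
  have v_C: "v x = u x" if "x \<in> C" for x using that by (simp add: v_def)
  have contC: "continuous_on C u" using cont by (simp add: C_def)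
  have vm: "v \<in> borel_measurable borel"
    unfolding v_def[abs_def] using borel_measurable_continuous_on_indicator[OF _ contC]
    by (simp add: C_def)
  have "bounded (u ` C)"
    by (intro compact_imp_bounded compact_continuous_image contC) (simp add: C_def)
  then obtain V where "0 < V" "\<And>x. x \<in> C \<Longrightarrow> \<bar>u x\<bar> \<le> V"
    unfolding bounded_pos by auto
  then have vB: "\<bar>v x\<bar> \<le> V" for x by (auto simp: v_def indicator_def)

  define \<eta> where "\<eta> = u x\<^sub>1 - m"
  have \<eta>: "0 < \<eta>" using m by (simp add: \<eta>_def)
  obtain d where d: "0 < d" "\<And>x y. x \<in> C \<Longrightarrow> y \<in> C \<Longrightarrow> dist y x < d \<Longrightarrow> \<bar>u y - u x\<bar> < \<eta> / 4"
    using compact_uniformly_continuous[OF contC] \<eta>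
    by (auto simp: uniformly_continuous_on_def C_def dist_real_def dest: spec[of _ "\<eta> / 4"])
  \<comment> \<open>Radius of mollification: the support stays in the ball and the oscillation of u on it is small.\<close>
  define r where "r = min (d / 2) (s' - s)"
  have r: "0 < r" using d s by (simp add: r_def)
  have ball_C: "cball z r \<subseteq> C" if "z \<in> cball x\<^sub>1 s" for z
    unfolding C_def using that by (intro cball_subset_cball_iff[THEN iffD2]) (auto simp: r_def dist_commute)
  have osc: "\<bar>u x - u z\<bar> < \<eta> / 4" if "z \<in> cball x\<^sub>1 s" "x \<in> cball z r" for x z
    using d(2)[of z x] ball_C[OF that(1)] that r d(1) by (force simp: r_def dist_commute)

  define I where "I = (LINT x|lborel. bump r (x :: 'a))"
  have I: "0 < I" unfolding I_def by (rule bump_mass_pos[OF r])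
  define U where "U z = (LINT x|lborel. v x * bump r (x - z))" for z
  have U_close: "\<bar>U z - u z * I\<bar> \<le> \<eta> / 4 * I" if "z \<in> cball x\<^sub>1 s" for z
    unfolding U_def I_def
    by (rule mollified_close[OF r vm vB]) (use osc[OF that] ball_C[OF that] v_C in fastforce)
  define W where "W z = U z - c * I * (dist x\<^sub>1 z)\<^sup>2" for z

  \<comment> \<open>The constraint that u is at least m keeps the maximum where the lower bound on h is available.\<close>
  define K where "K = {x \<in> cball x\<^sub>1 s. m \<le> u x}"
  have sC: "cball x\<^sub>1 s \<subseteq> C" using s by (auto simp: C_def)
  have "closed K"
    unfolding K_def
    by (intro continuous_on_closed_Collect_le continuous_on_const
        continuous_on_subset[OF contC sC] closed_cball)
  then have "compact K"
    using compact_Int_closed[of "cball x\<^sub>1 s" K] by (simp add: K_def Int_def conj_commute cong: conj_cong)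
  moreover have x1: "x\<^sub>1 \<in> K" using m s by (simp add: K_def)
  moreover have "continuous_on K W"
    unfolding W_def U_def by (intro continuous_intros mollified_continuous[OF r vm vB])
  ultimately obtain z where z: "z \<in> K" and z_max: "\<And>y. y \<in> K \<Longrightarrow> W y \<le> W z"
    using continuous_attains_sup[of K W] by blast
  have zs: "z \<in> cball x\<^sub>1 s" using z by (simp add: K_def)

  have "u x\<^sub>1 * I - \<eta> / 4 * I \<le> W x\<^sub>1"
    using U_close[of x\<^sub>1, unfolded abs_le_iff] s by (simp add: W_def)
  also have "\<dots> \<le> W z" by (rule z_max[OF x1])
  also have "\<dots> \<le> u z * I + \<eta> / 4 * I - c * I * (dist x\<^sub>1 z)\<^sup>2"
    using U_close[OF zs, unfolded abs_le_iff] by (simp add: W_def)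
  finally have "I * (u x\<^sub>1 - \<eta> / 4) \<le> I * (u z + \<eta> / 4 - c * (dist x\<^sub>1 z)\<^sup>2)"
    by (simp add: algebra_simps)
  then have "u x\<^sub>1 - \<eta> / 4 \<le> u z + \<eta> / 4 - c * (dist x\<^sub>1 z)\<^sup>2"
    using I by (simp only: mult_le_cancel_left_pos)
  then have uz: "m + \<eta> / 2 + c * (dist x\<^sub>1 z)\<^sup>2 \<le> u z"
    by (simp add: \<eta>_def field_simps)
  \<comment> \<open>The maximum point z is interior to K: on the sphere the negated conclusion contradicts uz.\<close>
  have z_int: "dist x\<^sub>1 z < s"
  proof (rule ccontr)
    assume "\<not> dist x\<^sub>1 z < s"
    with zs have "dist x\<^sub>1 z = s" by simp
    with uz u_le[OF zs] \<eta> show False by simp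
  qed
  have uz': "m + \<eta> / 2 \<le> u z" using uz c by (smt (verit) zero_le_power2 mult_nonneg_nonneg)
  have u_gt: "m < u x" if "x \<in> cball z r" for x
    using osc[OF zs that, unfolded abs_less_iff] uz' \<eta> by simp
  define \<rho> where "\<rho> = min r (s - dist x\<^sub>1 z)"
  have \<rho>: "0 < \<rho>" using r z_int by (simp add: \<rho>_def)
  have nearK: "y \<in> K" if "dist z y < \<rho>" for y
    using that u_gt[of y] dist_triangle[of x\<^sub>1 y z] by (auto simp: K_def \<rho>_def)

  define \<phi> where "\<phi> x = bump r (x - z)" for x
  have test: "\<phi> \<in> test_functions \<Omega>"
    unfolding \<phi>_def[abs_def] using ball_C[OF zs] sub
    by (intro test_function_bump[OF r]) (auto simp: C_def)
  have smooth: "C_infinity \<phi>" unfolding \<phi>_def[abs_def] by (rule C_infinity_bump)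
  have \<phi>_supp: "\<phi> x = 0" if "x \<notin> cball z r" for x
    using that bump_eq_0[OF r, of "x - z"] by (simp add: \<phi>_def dist_norm norm_minus_commute)
  have vm': "v \<in> borel_measurable lborel" using vm by simp
  note lim = second_difference_integral_tendsto[OF smooth _ \<phi>_supp vm' vB]

  have second: "(LINT x|lborel. v x * partial_deriv e (partial_deriv e \<phi>) x) \<le> 2 * c * I"
    if e: "e \<in> Basis" for e
  proof (rule LIMSEQ_le_const2[OF lim(2)[OF e]])
    obtain n\<^sub>0 where n\<^sub>0: "inverse (real (Suc n\<^sub>0)) < \<rho>" using reals_Archimedean[OF \<rho>] by blast
    show "\<exists>N. \<forall>n\<ge>N. (LINT x|lborel. v x * ((\<phi> (x + inverse (real (Suc n)) *\<^sub>R e)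
        + \<phi> (x - inverse (real (Suc n)) *\<^sub>R e) - 2 * \<phi> x) / (inverse (real (Suc n)))\<^sup>2)) \<le> 2 * c * I"
    proof (intro exI[of _ n\<^sub>0] allI impI)
      fix n assume "n\<^sub>0 \<le> n"
      define t where "t = inverse (real (Suc n))"
      have t: "0 < t" by (simp add: t_def)
      have "t \<le> inverse (real (Suc n\<^sub>0))" using \<open>n\<^sub>0 \<le> n\<close> by (simp add: t_def field_simps)
      with n\<^sub>0 have "t < \<rho>" by simp
      have "z + t *\<^sub>R e \<in> K" "z - t *\<^sub>R e \<in> K"
        using e t \<open>t < \<rho>\<close> by (auto intro!: nearK simp: dist_norm)
      then have "W (z + t *\<^sub>R e) + W (z - t *\<^sub>R e) \<le> 2 * W z"
        using z_max by (smt (verit))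
      then have "U (z + t *\<^sub>R e) + U (z - t *\<^sub>R e) - 2 * U z \<le>
         c * I * ((dist x\<^sub>1 (z + t *\<^sub>R e))\<^sup>2 + (dist x\<^sub>1 (z - t *\<^sub>R e))\<^sup>2 - 2 * (dist x\<^sub>1 z)\<^sup>2)"
        by (simp add: W_def algebra_simps)
      also have "(dist x\<^sub>1 (z + t *\<^sub>R e))\<^sup>2 + (dist x\<^sub>1 (z - t *\<^sub>R e))\<^sup>2 - 2 * (dist x\<^sub>1 z)\<^sup>2
          = 2 * t\<^sup>2 * (e \<bullet> e)"
        unfolding dist_norm power2_norm_eq_inner
        by (simp add: inner_diff inner_add inner_commute algebra_simps power2_eq_square)
      also have "\<dots> = 2 * t\<^sup>2" using e by (simp add: inner_same_Basis)
      finally have le: "U (z + t *\<^sub>R e) + U (z - t *\<^sub>R e) - 2 * U z \<le> 2 * c * I * t\<^sup>2"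
        by (simp add: algebra_simps)
      have "(LINT x|lborel. v x * ((\<phi> (x + t *\<^sub>R e) + \<phi> (x - t *\<^sub>R e) - 2 * \<phi> x) / t\<^sup>2))
          = (LINT x|lborel. (v x * bump r (x - (z - t *\<^sub>R e)) + v x * bump r (x - (z + t *\<^sub>R e))
              - 2 * (v x * bump r (x - z))) / t\<^sup>2)"
        by (simp add: \<phi>_def algebra_simps add_divide_distrib diff_divide_distrib)
      also have "\<dots> = (U (z - t *\<^sub>R e) + U (z + t *\<^sub>R e) - 2 * U z) / t\<^sup>2"
        unfolding U_def using integrable_mult_bump[OF r vm vB] by simp
      also have "\<dots> \<le> 2 * c * I"
        using le t by (simp add: divide_le_eq add.commute)
      finally show "(LINT x|lborel. v x * ((\<phi> (x + inverse (real (Suc n)) *\<^sub>R e)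
        + \<phi> (x - inverse (real (Suc n)) *\<^sub>R e) - 2 * \<phi> x) / (inverse (real (Suc n)))\<^sup>2)) \<le> 2 * c * I"
        by (simp only: t_def)
    qed
  qed

  have lap0: "laplacian \<phi> x = 0" if "x \<notin> cball z r" for x
    unfolding laplacian_def
    by (intro sum.neutral ballI, rule partial_deriv_eq_0_outside[OF
          partial_deriv_eq_0_outside[OF \<phi>_supp closed_cball] closed_cball that])
  have supp_C: "x \<in> C" "x \<in> \<Omega>" if "x \<in> cball z r" for x
    using that ball_C[OF zs] sub by (auto simp: C_def)
  have "(LINT x:\<Omega>|lebesgue. u x * laplacian \<phi> x) = (LINT x|lebesgue. v x * laplacian \<phi> x)"
    unfolding set_lebesgue_integral_def
  proof (rule Bochner_Integration.integral_cong[OF refl])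
    fix x
    show "indicator \<Omega> x *\<^sub>R (u x * laplacian \<phi> x) = v x * laplacian \<phi> x"
      using lap0[of x] supp_C[of x] v_C[of x] by (cases "x \<in> cball z r") auto
  qed
  also have "\<dots> = (LINT x|lborel. (\<Sum>e\<in>Basis. v x * partial_deriv e (partial_deriv e \<phi>) x))"
    unfolding laplacian_def sum_distrib_left
    by (rule integral_completion, rule borel_measurable_sum) (use lim(1) in blast)
  also have "\<dots> = (\<Sum>e\<in>Basis. (LINT x|lborel. v x * partial_deriv e (partial_deriv e \<phi>) x))"
    by (rule Bochner_Integration.integral_sum) (rule lim(1))
  also have "\<dots> \<le> (\<Sum>e\<in>(Basis :: 'a set). 2 * c * I)"
    by (rule sum_mono) (rule second)
  also have "\<dots> = \<kappa> * I / 2" by (simp add: c_def)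
  finally have upper: "(LINT x:\<Omega>|lebesgue. u x * laplacian \<phi> x) \<le> \<kappa> * I / 2" .

  have \<phi>_int: "integrable lborel \<phi>" unfolding \<phi>_def[abs_def] by (rule integrable_bump[OF r])
  have "\<kappa> * I = (LINT x|lborel. \<kappa> * \<phi> x)"
    unfolding I_def \<phi>_def using lborel_integral_shift[of "bump r" z] measurable_bump[of r "0 :: 'a"] by simp
  also have "\<dots> = (LINT x|lebesgue. \<kappa> * \<phi> x)"
    using \<phi>_int by (intro integral_completion[symmetric]) auto
  also have "\<dots> \<le> (LINT x|lebesgue. indicator C x *\<^sub>R h x * \<phi> x)"
  proof (rule integral_mono)
    show "integrable lebesgue (\<lambda>x. \<kappa> * \<phi> x)"
      using \<phi>_int by (simp add: integrable_completion)
    have hC: "integrable lebesgue (\<lambda>x. indicator C x *\<^sub>R h x)"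
      using h_int by (simp add: set_integrable_def C_def)
    show "integrable lebesgue (\<lambda>x. indicator C x *\<^sub>R h x * \<phi> x)"
    proof (rule Bochner_Integration.integrable_bound[OF hC])
      show "(\<lambda>x. indicator C x *\<^sub>R h x * \<phi> x) \<in> borel_measurable lebesgue"
        using hC measurable_completion[OF borel_measurable_integrable[OF \<phi>_int]]
        by (intro borel_measurable_times) auto
      show "AE x in lebesgue. norm (indicator C x *\<^sub>R h x * \<phi> x) \<le> norm (indicator C x *\<^sub>R h x)"
        by (intro AE_I2)
          (auto simp: \<phi>_def abs_mult bump_nonneg bump_le_1 intro!: mult_left_le)
    qed
    show "\<kappa> * \<phi> x \<le> indicator C x *\<^sub>R h x * \<phi> x" for x
    proof (cases "x \<in> cball z r")
      case True
      then have "x \<in> C" using ball_C[OF zs] by blast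
      then have "\<kappa> \<le> h x" using h_ge[of x] u_gt[OF True] by (simp add: C_def)
      with \<open>x \<in> C\<close> show ?thesis by (simp add: \<phi>_def bump_nonneg mult_right_mono)
    qed (simp add: \<phi>_supp)
  qed
  also have "\<dots> = (LINT x:\<Omega>|lebesgue. h x * \<phi> x)"
    unfolding set_lebesgue_integral_def
  proof (rule Bochner_Integration.integral_cong[OF refl])
    fix x
    show "indicator C x *\<^sub>R h x * \<phi> x = indicator \<Omega> x *\<^sub>R (h x * \<phi> x)"
      using \<phi>_supp[of x] supp_C[of x] by (cases "x \<in> cball z r") auto
  qed
  also have "\<dots> = (LINT x:\<Omega>|lebesgue. u x * laplacian \<phi> x)"
    using sol test by (simp add: distributional_laplacian_def)
  finally show False using upper mult_pos_pos[OF \<kappa> I] by simp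
qed

section \<open>The Keller-Osserman estimate\<close>

text \<open>
  On the dyadic interval from \<open>2\<^sup>k a\<close> to \<open>2\<^sup>k\<^sup>+\<^sup>1 a\<close> the primitive of \<open>f\<close> is at most
  \<open>2\<^sup>k\<^sup>+\<^sup>1 a f (2\<^sup>k\<^sup>+\<^sup>1 a)\<close>, so the integral over it is at least half of the summand of index \<open>k + 1\<close>.
  The integral starts at \<open>2 a\<close> and thus controls the summands of index at least 2; by monotonicity
  of \<open>f\<close> the first two are at most \<open>1\<close> and \<open>\<surd>2 \<le> 2\<close> times \<open>\<surd>(a / f a)\<close>.
\<close>

lemma keller_osserman_dyadic:
  fixes f :: "real \<Rightarrow> real"
  assumes mono: "mono_on {0..} f" and nonneg: "\<And>t. 0 \<le> t \<Longrightarrow> 0 \<le> f t"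
    and a: "0 < a" "0 < f a" and M: "0 \<le> M"
    and KO: "(\<integral>\<^sup>+t\<in>{2 * a..}. ennreal (1 / sqrt (integral {0..t} f)) \<partial>lborel) \<le> ennreal M"
  shows "(\<Sum>k<n. sqrt (2 ^ k * a / f (2 ^ k * a))) \<le> 3 * sqrt (a / f a) + 2 * M"
proof -
  define m where "m k = 2 ^ k * a" for k :: nat
  define b where "b k = sqrt (m k / f (m k))" for k
  define F where "F t = ennreal (1 / sqrt (integral {0..t} f))" for t
  define w where "w k = 1 / sqrt (m (k + 2) * f (m (k + 2)))" for k
  have f_mono: "f s \<le> f t" if "0 \<le> s" "s \<le> t" for s t
    using mono that by (auto simp: mono_on_def)
  have m_pos: "0 < m k" and m_Suc: "m (Suc k) = 2 * m k" for k
    using a by (simp_all add: m_def)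
  have a_m: "a \<le> m k" for k using a by (simp add: m_def)
  have fm: "0 < f (m k)" for k using a f_mono[OF _ a_m] by (meson less_imp_le less_le_trans)
  have f_int: "f integrable_on {s..t}" if "0 \<le> s" for s t
    using that by (intro integrable_on_mono_on mono_on_subset[OF mono]) auto

  have w_F: "ennreal (w k) \<le> F t" if t: "m (k + 1) \<le> t" "t < m (k + 2)" for k t
  proof -
    have at: "2 * a \<le> t" using t(1) a_m[of k] m_Suc[of k] by simp
    have "0 < (t - a) * f a" using at a by simp
    also have "\<dots> = integral {a..t} (\<lambda>_. f a)" using at a by simp
    also have "\<dots> \<le> integral {a..t} f"
      using at a by (intro integral_le f_int) (auto intro: f_mono)
    also have "\<dots> \<le> integral {0..t} f"
      using at a by (intro integral_subset_le f_int) (auto intro: nonneg)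
    finally have pos: "0 < integral {0..t} f" .
    have "integral {0..t} f \<le> integral {0..t} (\<lambda>_. f (m (k + 2)))"
      using t by (intro integral_le f_int) (auto intro: f_mono)
    also have "\<dots> = t * f (m (k + 2))" using at a by simp
    also have "\<dots> \<le> m (k + 2) * f (m (k + 2))"
      using t fm[of "k + 2"] by (intro mult_right_mono) auto
    finally show ?thesis
      unfolding F_def w_def using pos by (intro ennreal_leI divide_left_mono) auto
  qed

  have steps: "(\<Sum>k<n. ennreal (w k) * indicator {m (k + 1)..<m (k + 2)} t)
      \<le> F t * indicator {2 * a..<m (n + 1)} t" for t
  proof (induction n)
    case 0 then show ?case by simp
  next
    case (Suc n)
    consider "t < m (n + 1)" | "m (n + 1) \<le> t" "t < m (n + 2)" | "m (n + 2) \<le> t" by linarith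
    then show ?case
    proof cases
      case 1
      then have "t < m (n + 2)" using m_Suc[of "n + 1"] m_pos[of "n + 1"] by simp
      with 1 Suc show ?thesis by (simp add: indicator_def)
    next
      case 2
      have "2 * a \<le> t" using 2(1) a_m[of n] m_Suc[of n] by simp
      with 2 Suc w_F[OF 2] show ?thesis by (simp add: indicator_def)
    next
      case 3
      then have "m (n + 1) \<le> t" using m_Suc[of "n + 1"] m_pos[of "n + 1"] by simp
      with 3 Suc show ?thesis by (simp add: indicator_def)
    qed
  qed

  have wb: "w k * m (k + 1) = b (k + 2) / 2" for k
  proof -
    have "w k * m (k + 2) = b (k + 2)"
      using real_div_sqrt[OF less_imp_le[OF m_pos[of "k + 2"]]]
      by (simp add: w_def b_def real_sqrt_mult real_sqrt_divide flip: divide_divide_eq_left)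
    with m_Suc[of "k + 1"] show ?thesis by simp
  qed
  have w_pos: "0 \<le> w k" and b_pos: "0 \<le> b k" for k
    using m_pos fm by (simp_all add: w_def b_def less_imp_le)

  have area: "ennreal (b (k + 2) / 2) = ennreal (w k) * ennreal (m (k + 2) - m (k + 1))" for k
  proof -
    have "m (k + 2) - m (k + 1) = m (k + 1)" using m_Suc[of "k + 1"] by simp
    then show ?thesis
      using w_pos[of k] m_pos[of "k + 1"] by (simp only: wb[symmetric] ennreal_mult less_imp_le)
  qed
  have "ennreal (\<Sum>k<n. b (k + 2) / 2) = (\<Sum>k<n. ennreal (w k) * ennreal (m (k + 2) - m (k + 1)))"
    unfolding area[symmetric] using b_pos by (intro sum_ennreal[symmetric]) simp
  also have "\<dots> = (\<Sum>k<n. \<integral>\<^sup>+t. ennreal (w k) * indicator {m (k + 1)..<m (k + 2)} t \<partial>lborel)"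
    using m_pos m_Suc by (intro sum.cong) (simp_all add: nn_integral_cmult less_imp_le)
  also have "\<dots> = (\<integral>\<^sup>+t. (\<Sum>k<n. ennreal (w k) * indicator {m (k + 1)..<m (k + 2)} t) \<partial>lborel)"
    by (rule nn_integral_sum[symmetric]) simp
  also have "\<dots> \<le> (\<integral>\<^sup>+t\<in>{2 * a..}. F t \<partial>lborel)"
    by (intro nn_integral_mono order_trans[OF steps]) (auto simp: indicator_def)
  also have "\<dots> \<le> ennreal M" using KO by (simp add: F_def)
  finally have tail: "(\<Sum>k<n. b (k + 2)) \<le> 2 * M"
    using M by (simp add: ennreal_le_iff flip: sum_divide_distrib)

  have "b 1 \<le> sqrt (4 * (a / f a))"
    unfolding b_def
    using a fm[of 1] f_mono[OF _ a_m[of 1]] by (intro real_sqrt_le_mono) (simp add: m_def frac_le)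
  also have "\<dots> = 2 * sqrt (a / f a)" by (simp only: real_sqrt_mult real_sqrt_four)
  finally have b1: "b 1 \<le> 2 * sqrt (a / f a)" .
  have "(\<Sum>k<n. b k) \<le> (\<Sum>k<n + 2. b k)"
    by (intro sum_mono2) (auto simp: b_pos)
  also have "\<dots> = b 0 + b 1 + (\<Sum>k<n. b (k + 2))"
    by (simp add: sum.lessThan_Suc_shift del: sum.lessThan_Suc)
  also have "\<dots> \<le> 3 * sqrt (a / f a) + 2 * M"
    using b1 tail by (simp add: b_def m_def)
  finally show ?thesis by (simp add: b_def m_def)
qed

text \<open>
  If \<open>u x\<^sub>0 > a\<close>, the radius in \<open>laplacian_growth\<close> that doubles the level \<open>2\<^sup>k a\<close> is the
  \<open>k\<close>-th summand of \<open>len\<close>. Iteration produces points at which \<open>u\<close> exceeds all \<open>2\<^sup>n a\<close>, and the path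
  through them has length at most \<open>T\<close>. It stays in a compact ball, on which \<open>u\<close> is bounded.
\<close>

lemma keller_osserman_bound:
  fixes u h :: "'a::euclidean_space \<Rightarrow> real" and f :: "real \<Rightarrow> real"
  assumes sol: "distributional_laplacian \<Omega> u h"
    and cont: "continuous_on \<Omega> u" and h_int: "L1_loc \<Omega> h" and sub: "ball x\<^sub>0 R \<subseteq> \<Omega>"
    and h_ge: "\<And>x. x \<in> ball x\<^sub>0 R \<Longrightarrow> f (u x) \<le> h x"
    and mono: "mono_on {0..} f" and a: "0 < a" "0 < f a"
    and len: "\<And>n. (\<Sum>k<n. sqrt (4 * real DIM('a) * (2 ^ k * a / f (2 ^ k * a)))) \<le> T" and T: "T < R"
  shows "u x\<^sub>0 \<le> a"
proof (rule ccontr)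
  assume "\<not> u x\<^sub>0 \<le> a"
  then have start: "a < u x\<^sub>0" by simp
  define s where "s k = sqrt (4 * real DIM('a) * (2 ^ k * a / f (2 ^ k * a)))" for k :: nat
  have a_k: "a \<le> 2 ^ k * a" for k using a by simp
  have f_pos: "0 < f (2 ^ k * a)" for k
    using a a_k[of k] mono by (force simp: mono_on_def intro: less_le_trans)
  have s_pos: "0 \<le> s k" for k using a f_pos by (simp add: s_def less_imp_le)
  have path: "\<exists>x. dist x\<^sub>0 x \<le> (\<Sum>k<n. s k) \<and> 2 ^ n * a < u x" for n
  proof (induction n)
    case 0 with start show ?case by (intro exI[of _ x\<^sub>0]) simp
  next
    case (Suc n)
    then obtain x where x: "dist x\<^sub>0 x \<le> (\<Sum>k<n. s k)" "2 ^ n * a < u x" by blast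
    have "dist x\<^sub>0 x + s n \<le> T" using x(1) len[of "Suc n"] by (simp add: s_def)
    then have "cball x (s n + (R - T) / 2) \<subseteq> ball x\<^sub>0 R"
      using T by (intro cball_subset_ball_iff[THEN iffD2]) (simp add: dist_commute field_simps)
    note inside = this order_trans[OF this sub]
    have "\<exists>y\<in>cball x (s n). 2 ^ n * a + f (2 ^ n * a) / (4 * real DIM('a)) * (s n)\<^sup>2 < u y"
    proof (rule laplacian_growth[OF sol continuous_on_subset[OF cont inside(2)] _ inside(2) s_pos _ x(2) f_pos])
      show "set_integrable lebesgue (cball x (s n + (R - T) / 2)) h"
        using h_int inside(2) by (simp add: L1_loc_def)
      show "f (2 ^ n * a) \<le> h y" if "y \<in> cball x (s n + (R - T) / 2)" "2 ^ n * a < u y" for y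
      proof -
        have "f (2 ^ n * a) \<le> f (u y)"
        proof (rule mono_onD[OF mono])
          have "0 \<le> 2 ^ n * a" using a(1) by simp
          then show "2 ^ n * a \<in> {0..}" "u y \<in> {0..}" using that(2) by auto
        qed (use that(2) in simp)
        also have "\<dots> \<le> h y" using h_ge inside(1) that(1) by blast
        finally show ?thesis .
      qed
    qed (use T in simp)
    then obtain y where y: "dist x y \<le> s n"
      and uy: "2 ^ n * a + f (2 ^ n * a) / (4 * real DIM('a)) * (s n)\<^sup>2 < u y" by auto
    have "f (2 ^ n * a) / (4 * real DIM('a)) * (s n)\<^sup>2 = 2 ^ n * a"
      using a f_pos[of n] by (simp add: s_def less_imp_le)
    moreover have "2 ^ Suc n * a = 2 ^ n * a + 2 ^ n * a" by simp
    ultimately have "2 ^ Suc n * a < u y" using uy by linarith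
    moreover have "dist x\<^sub>0 y \<le> (\<Sum>k<Suc n. s k)"
      using x(1) y dist_triangle[of x\<^sub>0 y x] by simp
    ultimately show ?case by blast
  qed
  have "cball x\<^sub>0 T \<subseteq> \<Omega>" using sub T by force
  then have "compact (u ` cball x\<^sub>0 T)"
    by (intro compact_continuous_image continuous_on_subset[OF cont]) auto
  then obtain B where B: "\<And>x. x \<in> cball x\<^sub>0 T \<Longrightarrow> \<bar>u x\<bar> \<le> B"
    using compact_imp_bounded[THEN bounded_iff[THEN iffD1]] by (metis image_eqI real_norm_def)
  obtain n where n: "B / a < 2 ^ n" using real_arch_pow[of 2 "B / a"] by auto
  obtain x where "dist x\<^sub>0 x \<le> (\<Sum>k<n. s k)" "2 ^ n * a < u x" using path by blast
  moreover have "x \<in> cball x\<^sub>0 T" using calculation(1) len[of n] by (simp add: s_def)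
  ultimately show False using B[of x] n a by (simp add: field_simps)
qed

section \<open>The distance to the boundary\<close>

lemma ball_bdist_subset:
  assumes "ereal R \<le> bdist \<Omega> x"
  shows "ball x R \<subseteq> \<Omega>"
proof
  fix y assume y: "y \<in> ball x R"
  show "y \<in> \<Omega>"
  proof (rule ccontr)
    assume "y \<notin> \<Omega>"
    then have "bdist \<Omega> x \<le> ereal (dist x y)" unfolding bdist_def by (intro INF_lower) simp
    also have "\<dots> < ereal R" using y by simp
    finally show False using assms by simp
  qed
qed

text \<open>
  Used with the roles of centre and nearby point exchanged: the comparison hypothesis at \<open>x\<close> bounds
  the nonlinearity at \<open>x\<^sub>0\<close> by the one at \<open>x\<close>, which is the direction that makes \<open>u\<close> a subsolution of an
  autonomous inequality near \<open>x\<^sub>0\<close>.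
\<close>

lemma bdist_half:
  assumes "ereal (3 * R) \<le> bdist \<Omega> x\<^sub>0" "x \<in> ball x\<^sub>0 R"
  shows "ereal (dist x\<^sub>0 x) \<le> bdist \<Omega> x / 2"
proof -
  have "ereal (2 * R) \<le> bdist \<Omega> x"
    unfolding bdist_def
  proof (rule INF_greatest)
    fix y assume "y \<in> - \<Omega>"
    then have "bdist \<Omega> x\<^sub>0 \<le> ereal (dist x\<^sub>0 y)" unfolding bdist_def by (rule INF_lower)
    with assms(1) have "ereal (3 * R) \<le> ereal (dist x\<^sub>0 y)" by (rule order_trans)
    then show "ereal (2 * R) \<le> ereal (dist x y)"
      using assms(2) dist_triangle[of x\<^sub>0 y x] by simp
  qed
  then have "ereal (2 * R) / 2 \<le> bdist \<Omega> x / 2" by (rule ereal_divide_right_mono) simp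
  moreover have "ereal (dist x\<^sub>0 x) \<le> ereal (2 * R) / 2" using assms(2) by simp
  ultimately show ?thesis by (rule order_trans[rotated])
qed

text \<open>
  This treats finite and infinite distance together: in the second case \<open>p = 0\<close>, and a ball of any
  radius is available.
\<close>

lemma inverse_bdist_cases:
  assumes "open \<Omega>" "x \<in> \<Omega>"
  obtains p where "0 \<le> p" "inverse ((bdist \<Omega> x)\<^sup>2) = ereal p"
    "\<And>T. 0 \<le> T \<Longrightarrow> 9 * T\<^sup>2 * p < 1 \<Longrightarrow> \<exists>R>T. ereal (3 * R) \<le> bdist \<Omega> x"
proof -
  obtain e where e: "0 < e" "ball x e \<subseteq> \<Omega>" using openE[OF assms] .
  have low: "ereal e \<le> bdist \<Omega> x"
    unfolding bdist_def
  proof (rule INF_greatest)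
    fix y assume "y \<in> - \<Omega>"
    then have "y \<notin> ball x e" using e(2) by blast
    then show "ereal e \<le> ereal (dist x y)" by simp
  qed
  show ?thesis
  proof (cases "bdist \<Omega> x")
    case (real d)
    with low e have d: "0 < d" by simp
    show ?thesis
    proof (rule that[of "inverse (d\<^sup>2)"])
      show "inverse ((bdist \<Omega> x)\<^sup>2) = ereal (inverse (d\<^sup>2))"
        using d by (simp add: real)
      fix T :: real assume "0 \<le> T" "9 * T\<^sup>2 * inverse (d\<^sup>2) < 1"
      have "inverse (d\<^sup>2) * d\<^sup>2 = 1" using d by (intro left_inverse) simp
      moreover have "(3 * T)\<^sup>2 = 9 * T\<^sup>2" by (simp add: power_mult_distrib)
      moreover have "9 * T\<^sup>2 * inverse (d\<^sup>2) * d\<^sup>2 < 1 * d\<^sup>2"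
        by (rule mult_strict_right_mono[OF \<open>9 * T\<^sup>2 * inverse (d\<^sup>2) < 1\<close>]) (use d in simp)
      ultimately have "(3 * T)\<^sup>2 < d\<^sup>2" by (simp only: mult.assoc mult_1_left mult_1_right)
      then have "3 * T < d" using d by (rule power2_less_imp_less[OF _ less_imp_le])
      then show "\<exists>R>T. ereal (3 * R) \<le> bdist \<Omega> x"
        using real by (intro exI[of _ "d / 3"]) simp
    qed simp
  next
    case PInf
    show ?thesis
    proof (rule that[of 0])
      show "inverse ((bdist \<Omega> x)\<^sup>2) = ereal 0"
        using PInf by (simp add: power2_eq_square zero_ereal_def)
      show "\<exists>R>T. ereal (3 * R) \<le> bdist \<Omega> x" for T
        by (intro exI[of _ "T + 1"]) (simp add: PInf)
    qed simp
  next
    case MInf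
    with low show ?thesis by simp
  qed
qed

section \<open>The a priori bound\<close>

theorem propositionA1:
  fixes c\<^sub>0 C\<^sub>1 C\<^sub>2 :: real
  assumes "c\<^sub>0 > 0" and "C\<^sub>1 \<ge> 1" and "C\<^sub>2 > 0"
  shows "\<exists>cbar>0. \<forall>(\<Omega> :: (real ^ 'n) set) (g :: real ^ 'n \<Rightarrow> real \<Rightarrow> real).
    open \<Omega> \<and> connected \<Omega> \<and> \<Omega> \<noteq> {} \<and>
    continuous_on (\<Omega> \<times> {0..}) (\<lambda>(x, t). g x t) \<and>
    cond_ND \<Omega> g \<and> cond_H C\<^sub>1 \<Omega> g \<and> cond_KOT C\<^sub>2 c\<^sub>0 \<Omega> g \<longrightarrow>
    (\<forall>u. nonneg_solution \<Omega> g u \<longrightarrow>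
      (\<forall>x\<in>\<Omega>. ereal (g x (u x)) \<le> ereal (cbar * u x) * inverse ((bdist \<Omega> x)\<^sup>2)))"
proof -
  define N where "N = real DIM(real ^ 'n)"
  have N: "0 < N" by (simp add: N_def)
  define A where "A = sqrt (4 * N * C\<^sub>1) * (3 + 2 * C\<^sub>2)"
  define cbar where "cbar = c\<^sub>0 + 9 * A\<^sup>2"
  have A: "0 < A" using assms N by (simp add: A_def)
  have cbar: "0 < cbar" using assms by (simp add: cbar_def add_pos_nonneg)
  have "ereal (g x\<^sub>0 (u x\<^sub>0)) \<le> ereal (cbar * u x\<^sub>0) * inverse ((bdist \<Omega> x\<^sub>0)\<^sup>2)"
    if "open \<Omega>" and cont: "continuous_on (\<Omega> \<times> {0..}) (\<lambda>(x, t). g x t)"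
      and ND: "cond_ND \<Omega> g" and H: "cond_H C\<^sub>1 \<Omega> g" and KOT: "cond_KOT C\<^sub>2 c\<^sub>0 \<Omega> g"
      and sol: "nonneg_solution \<Omega> g u" and x0: "x\<^sub>0 \<in> \<Omega>"
    for \<Omega> :: "(real ^ 'n) set" and g u x\<^sub>0
  proof (rule ccontr)
    obtain p where p: "0 \<le> p" "inverse ((bdist \<Omega> x\<^sub>0)\<^sup>2) = ereal p"
      and room: "\<And>T. 0 \<le> T \<Longrightarrow> 9 * T\<^sup>2 * p < 1 \<Longrightarrow> \<exists>R>T. ereal (3 * R) \<le> bdist \<Omega> x\<^sub>0"
      using inverse_bdist_cases[OF \<open>open \<Omega>\<close> x0] by blast
    let ?f = "g x\<^sub>0"
    have nonneg: "0 \<le> ?f t" if "0 \<le> t" for t using ND x0 that by (simp add: cond_ND_def)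
    have mono: "mono_on {0..} ?f" using ND x0 by (simp add: cond_ND_def)
    have f_cont: "continuous_on {0..} ?f"
    proof -
      have "continuous_on {0..} (\<lambda>t. case (x\<^sub>0, t) of (x, t) \<Rightarrow> g x t)"
        by (rule continuous_on_compose2[OF cont]) (use x0 in \<open>auto intro!: continuous_intros\<close>)
      then show ?thesis by simp
    qed
    \<comment> \<open>The condition on a is the hypothesis of the integral condition, cleared of the division.\<close>
    have sums: "(\<Sum>k<n. sqrt (2 ^ k * a / ?f (2 ^ k * a))) \<le> (3 + 2 * C\<^sub>2) * sqrt (a / ?f a)"
      if a: "0 < a" "c\<^sub>0 * p * a < ?f a" for a n
    proof -
      have fa: "0 < ?f a" using a p(1) assms(1) by (smt (verit) mult_nonneg_nonneg)
      have "c\<^sub>0 * p < ?f a / a" using a by (simp add: field_simps)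
      then have "ereal c\<^sub>0 * inverse ((bdist \<Omega> x\<^sub>0)\<^sup>2) < ereal (?f a / a)" by (simp add: p(2))
      then have "(\<integral>\<^sup>+t\<in>{2 * a..}. ennreal (1 / sqrt (integral {0..t} ?f)) \<partial>lborel)
          \<le> ennreal (C\<^sub>2 * sqrt (a / ?f a))"
        using KOT x0 a(1) by (simp add: cond_KOT_def primitive_def)
      from keller_osserman_dyadic[OF mono nonneg a(1) fa _ this, of n] a(1) fa assms(3)
      show ?thesis by (simp add: algebra_simps)
    qed

    assume "\<not> ?thesis"
    then have large: "cbar * u x\<^sub>0 * p < ?f (u x\<^sub>0)" by (simp add: p(2) not_le)
    have u0: "0 \<le> u x\<^sub>0" using sol x0 by (simp add: nonneg_solution_def)
    show False
    proof (cases "u x\<^sub>0 = 0")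
      case True
      with large have f0: "0 < ?f 0" by simp
      have f_ge: "?f 0 \<le> ?f t" if "0 \<le> t" for t using mono that by (auto simp: mono_on_def)
      \<comment> \<open>If g were positive at 0, the integral condition would hold for all small a; with a = 1/2^n the n-th summand is the fixed number sqrt (1 / g x0 1), while the bound tends to 0.\<close>
      have "\<forall>\<^sub>F n in sequentially. sqrt (1 / ?f 1) \<le> (3 + 2 * C\<^sub>2) * sqrt ((1 / 2) ^ n / ?f 0)"
      proof -
        have "(\<lambda>n. c\<^sub>0 * p * (1 / 2) ^ n) \<longlonglongrightarrow> c\<^sub>0 * p * 0"
          by (intro tendsto_mult_left LIMSEQ_power_zero) simp
        then have "\<forall>\<^sub>F n in sequentially. c\<^sub>0 * p * (1 / 2) ^ n < ?f 0"
          using f0 by (intro order_tendstoD) auto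
        then show ?thesis
        proof eventually_elim
          case (elim n)
          define a :: real where "a = (1 / 2) ^ n"
          have a: "0 < a" by (simp add: a_def)
          have "2 ^ n * a = 1" by (simp add: a_def power_one_over)
          then have "sqrt (1 / ?f 1) = sqrt (2 ^ n * a / ?f (2 ^ n * a))" by simp
          also have "\<dots> \<le> (\<Sum>k<Suc n. sqrt (2 ^ k * a / ?f (2 ^ k * a)))"
            using a by (intro member_le_sum) (auto intro!: divide_nonneg_nonneg nonneg)
          also have "\<dots> \<le> (3 + 2 * C\<^sub>2) * sqrt (a / ?f a)"
            using elim f_ge[of a] a by (intro sums) (auto simp: a_def)
          also have "\<dots> \<le> (3 + 2 * C\<^sub>2) * sqrt (a / ?f 0)"
            using f_ge[of a] a f0 assms(3)
            by (intro mult_left_mono real_sqrt_le_mono frac_le) auto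
          finally show ?case by (simp add: a_def)
        qed
      qed
      moreover have "(\<lambda>n. (3 + 2 * C\<^sub>2) * sqrt ((1 / 2) ^ n / ?f 0)) \<longlonglongrightarrow> (3 + 2 * C\<^sub>2) * sqrt (0 / ?f 0)"
        by (intro tendsto_intros LIMSEQ_power_zero) (use f0 in auto)
      ultimately have "sqrt (1 / ?f 1) \<le> (3 + 2 * C\<^sub>2) * sqrt (0 / ?f 0)"
        by (intro tendsto_lowerbound) auto
      then show False using f_ge[of 1] f0 by (simp add: divide_le_0_iff)
    next
      case False
      with u0 have u_pos: "0 < u x\<^sub>0" by simp
      \<comment> \<open>The growth argument needs u x0 > a strictly, so the assumed inequality is moved to a slightly smaller value by continuity.\<close>
      define d where "d t = ?f t - cbar * t * p" for t
      have "continuous_on {0..} d" unfolding d_def by (intro continuous_intros f_cont)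
      then have "isCont d (u x\<^sub>0)"
        using u_pos by (intro continuous_on_interior[of "{0..}"]) (auto simp: interior_real_atLeast)
      then have "\<forall>\<^sub>F t in at (u x\<^sub>0). 0 < d t"
        using large by (intro order_tendstoD(1)[of d "d (u x\<^sub>0)"]) (auto simp: isCont_def d_def)
      then have "\<forall>\<^sub>F t in at_left (u x\<^sub>0). 0 < d t"
        using eventually_at_split by blast
      moreover have "\<forall>\<^sub>F t in at_left (u x\<^sub>0). 0 < t"
        using u_pos by (auto simp: eventually_at_left_field)
      moreover have "\<forall>\<^sub>F t in at_left (u x\<^sub>0). t < u x\<^sub>0"
        by (simp add: eventually_at_filter)
      ultimately have "\<forall>\<^sub>F t in at_left (u x\<^sub>0). 0 < t \<and> t < u x\<^sub>0 \<and> 0 < d t"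
        by eventually_elim simp
      then have "\<exists>t. 0 < t \<and> t < u x\<^sub>0 \<and> 0 < d t"
        by (rule eventually_happens'[OF trivial_limit_at_left_real])
      then obtain a where a: "0 < a" "a < u x\<^sub>0" and da: "cbar * a * p < ?f a"
        by (auto simp: d_def)
      have "0 \<le> c\<^sub>0 * p * a" "0 \<le> 9 * A\<^sup>2 * p * a" using a(1) p(1) assms(1) by simp_all
      moreover have "cbar * a * p = c\<^sub>0 * p * a + 9 * A\<^sup>2 * p * a"
        by (simp add: cbar_def algebra_simps)
      ultimately have parts: "c\<^sub>0 * p * a < ?f a" "9 * A\<^sup>2 * p * a < ?f a" using da by linarith+
      have fa: "0 < ?f a" using parts(2) a(1) p(1) by (smt (verit) mult_nonneg_nonneg zero_le_power2)
      define T where "T = A * sqrt (a / ?f a)"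
      have "9 * T\<^sup>2 * p < 1"
        using parts(2) a(1) fa by (simp add: T_def power_mult_distrib mult_ac)
      moreover have "0 \<le> T" using A a(1) fa by (simp add: T_def)
      ultimately obtain R where R: "T < R" "ereal (3 * R) \<le> bdist \<Omega> x\<^sub>0" using room by blast
      have "ereal R \<le> ereal (3 * R)" using R(1) \<open>0 \<le> T\<close> by simp
      then have sub: "ball x\<^sub>0 R \<subseteq> \<Omega>" using R(2) by (intro ball_bdist_subset) (rule order_trans)
      have "u x\<^sub>0 \<le> a"
      proof (rule keller_osserman_bound[where f = "\<lambda>t. ?f t / C\<^sub>1" and h = "\<lambda>x. g x (u x)"])
        show "distributional_laplacian \<Omega> u (\<lambda>x. g x (u x))" "continuous_on \<Omega> u"
          "L1_loc \<Omega> (\<lambda>x. g x (u x))"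
          using sol by (simp_all add: nonneg_solution_def)
        show "?f (u x) / C\<^sub>1 \<le> g x (u x)" if x: "x \<in> ball x\<^sub>0 R" for x
        proof -
          have "x \<in> \<Omega>" using sub x by blast
          moreover have "0 \<le> u x" using sol calculation by (simp add: nonneg_solution_def)
          ultimately have "?f (u x) \<le> C\<^sub>1 * g x (u x)"
            using H x0 bdist_half[OF R(2) x] unfolding cond_H_def by blast
          then show ?thesis using assms(2) by (simp add: field_simps)
        qed
        show "mono_on {0..} (\<lambda>t. ?f t / C\<^sub>1)"
          using mono assms(2) by (auto simp: mono_on_def divide_right_mono)
        show "(\<Sum>k<n. sqrt (4 * real DIM(real ^ 'n) * (2 ^ k * a / (?f (2 ^ k * a) / C\<^sub>1)))) \<le> T" for n
        proof -
          have "(\<Sum>k<n. sqrt (4 * real DIM(real ^ 'n) * (2 ^ k * a / (?f (2 ^ k * a) / C\<^sub>1))))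
              = sqrt (4 * N * C\<^sub>1) * (\<Sum>k<n. sqrt (2 ^ k * a / ?f (2 ^ k * a)))"
            unfolding sum_distrib_left N_def real_sqrt_mult[symmetric]
            by (intro sum.cong arg_cong[of _ _ sqrt]) (simp_all add: mult_ac)
          also have "\<dots> \<le> sqrt (4 * N * C\<^sub>1) * ((3 + 2 * C\<^sub>2) * sqrt (a / ?f a))"
            using sums[OF a(1) parts(1)] N assms(2) by (intro mult_left_mono) auto
          finally show ?thesis by (simp add: T_def A_def)
        qed
      qed (use sub R a fa assms(2) in auto)
      with a(2) show False by simp
    qed
  qed
  with cbar show ?thesis by blast
qed

end
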